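(* Let $x_1,x_2,x_3$ be three nonnegative real numbers. Then: (a) $x_1^4+x_2^4+x_3^4+6x_1^2x_2^2+6x_1^2x_3^2+6x_2^2x_3^2+12x_1^2x_2x_3+12x_1x_2x_3^2+12x_1x_2^2x_3\geq 4x_1^3x_3+4x_1x_2^3+4x_2^3x_3+4x_2x_3^3+4x_1^3x_2+4x_1x_3^3$, or equivalently $(x_1+x_2+x_3)^4\geq8(x_1^3x_3+x_1x_2^3+x_2^3x_3+x_2x_3^3+x_1^3x_2+x_1x_3^3)$, with equality if and only if two of $x_1,x_2,x_3$ are equal and the third is $0$; (b) $x_1^4+x_2^4+x_3^4+6x_1^2x_2^2+6x_1^2x_3^2+6x_2^2x_3^2+12x_1^2x_2x_3+12x_1x_2x_3^2+4x_1x_2^3\geq 4x_1^3x_3+4x_1x_3^3+4x_2^3x_3+4x_2x_3^3+4x_1^3x_2+12x_1x_2^2x_3$, or equivalently $(x_1+x_2-x_3)^4\geq8x_1^2x_2(x_1-3x_3)$, with equality if and only if ($x_1=0$ and $x_3=x_2$) or ($x_2=0$ and $x_1=x_3$); (c) $x_1^4+x_2^4+x_3^4+6x_1^2x_2^2+6x_1^2x_3^2+6x_2^2x_3^2+12x_1x_2^2x_3+12x_1x_2x_3^2+4x_1^3x_3\geq 4x_1x_2^3+4x_1x_3^3+4x_2^3x_3+4x_2x_3^3+4x_1^3x_2+12x_1^2x_2x_3$, or equivalently $(x_1-x_2+x_3)^4\geq8x_1x_3^2(x_3-3x_2)$, with equality if and only if ($x_1=x_2$ and $x_3=0$) or ($x_1=0$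 and $x_2=x_3$); (d) $x_1^4+x_2^4+x_3^4+6x_1^2x_2^2+6x_1^2x_3^2+6x_2^2x_3^2+12x_1x_2^2x_3+12x_1^2x_2x_3+4x_2x_3^3\geq 4x_1^3x_3+4x_1x_3^3+4x_2^3x_3+4x_1x_2^3+4x_1^3x_2+12x_1x_2x_3^2$, or equivalently $(x_2+x_3-x_1)^4\geq8x_2^2x_3(x_2-3x_1)$, with equality if and only if ($x_1=x_2$ and $x_3=0$) or ($x_2=0$ and $x_1=x_3$). *)

theory Defs
  imports "HOL-Analysis.Analysis"
begin

end

theory Submission
  imports Defs
begin

text \<open>
  In each part the difference of the two sides is the same polynomial in both formulations, so only
  the fourth-power forms matter.

  For (a), write \<open>p\<close>, \<open>q\<close>, \<open>r\<close> for the elementary symmetric polynomials of the three variables.  The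
  sum of all \<open>x\<^sub>i\<^sup>3 x\<^sub>j\<close> with \<open>i \<noteq> j\<close> is \<open>q (p\<^sup>2 - 2 q) - p r\<close>, so the difference of the two sides is
  \<open>(p\<^sup>2 - 4 q)\<^sup>2 + 8 p r\<close>.  It is nonnegative, and it vanishes only if one variable is \<open>0\<close>; the
  remaining square is then the fourth power of the difference of the other two variables.  This is
  \<open>symmetric_quartic_nonneg\<close>.

  Parts (b), (c) and (d) are instances of one inequality, \<open>fourth_power_ge_cubic_product\<close>,
  \<open>(a + b - c)\<^sup>4 \<ge> 8 a\<^sup>2 b (a - 3 c)\<close>, with \<open>(a, b, c)\<close> equal to \<open>(x\<^sub>1, x\<^sub>2, x\<^sub>3)\<close>, \<open>(x\<^sub>3, x\<^sub>1, x\<^sub>2)\<close> and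
  \<open>(x\<^sub>2, x\<^sub>3, x\<^sub>1)\<close>.  If \<open>a < c\<close>, the right-hand side is at most \<open>0\<close>.  If \<open>a \<ge> c\<close>, then \<open>8 (a - c)\<^sup>3 b\<close>
  separates the two sides: it exceeds the right-hand side by \<open>8 b c\<^sup>2 (3 a - c) \<ge> 0\<close>, and it is at
  most \<open>(a + b - c)\<^sup>4\<close> because \<open>(d + b)\<^sup>4 - 8 d\<^sup>3 b\<close> is a sum of nonnegative terms for
  \<open>d, b \<ge> 0\<close>.
\<close>

lemma symmetric_quartic_nonneg:
  fixes x y z :: real
  assumes "x \<ge> 0" "y \<ge> 0" "z \<ge> 0"
  defines "D \<equiv> (x + y + z)^4 - 8 * (x^3 * z + x * y^3 + y^3 * z + y * z^3 + x^3 * y + x * z^3)"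
  shows "D \<ge> 0"
    and "D = 0 \<longleftrightarrow> (x = y \<and> z = 0) \<or> (x = z \<and> y = 0) \<or> (y = z \<and> x = 0)"
proof -
  let ?s = "(x + y + z)^2 - 4 * (x * y + x * z + y * z)"
  let ?t = "8 * ((x + y + z) * (x * y * z))"
  have D: "D = ?s^2 + ?t"
    unfolding D_def by algebra
  have t: "?t \<ge> 0"
    using assms by simp
  show "D \<ge> 0"
    unfolding D using t by simp
  show "D = 0 \<longleftrightarrow> (x = y \<and> z = 0) \<or> (x = z \<and> y = 0) \<or> (y = z \<and> x = 0)"
  proof
    assume "D = 0"
    then have s0: "?s = 0" and t0: "?t = 0"
      using t add_nonneg_eq_0_iff[of "?s^2" ?t] unfolding D by auto
    have "x = 0 \<or> y = 0 \<or> z = 0"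
      using t0 assms by auto
    then show "(x = y \<and> z = 0) \<or> (x = z \<and> y = 0) \<or> (y = z \<and> x = 0)"
    proof (elim disjE)
      assume "x = 0"
      moreover from this have "(y - z)^2 = 0" using s0 by algebra
      ultimately show ?thesis by simp
    next
      assume "y = 0"
      moreover from this have "(x - z)^2 = 0" using s0 by algebra
      ultimately show ?thesis by simp
    next
      assume "z = 0"
      moreover from this have "(x - y)^2 = 0" using s0 by algebra
      ultimately show ?thesis by simp
    qed
  next
    assume "(x = y \<and> z = 0) \<or> (x = z \<and> y = 0) \<or> (y = z \<and> x = 0)"
    then show "D = 0"
      unfolding D_def by (auto simp: power4_eq_xxxx power3_eq_cube algebra_simps)
  qed
qed

text \<open>
  Equality forces \<open>a = 0\<close> or \<open>b = 0\<close>: for \<open>a < c\<close> because \<open>D\<close> is the sum of the nonnegative numbers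
  \<open>(a + b - c)\<^sup>4\<close> and \<open>8 a\<^sup>2 b (3 c - a)\<close>, and for \<open>a \<ge> c\<close> because \<open>D \<ge> b\<^sup>4\<close>.
\<close>

lemma fourth_power_ge_cubic_product:
  fixes a b c :: real
  assumes "a \<ge> 0" "b \<ge> 0" "c \<ge> 0"
  defines "D \<equiv> (a + b - c)^4 - 8 * a^2 * b * (a - 3 * c)"
  shows "D \<ge> 0"
    and "D = 0 \<longleftrightarrow> (a = 0 \<and> c = b) \<or> (b = 0 \<and> a = c)"
proof -
  let ?E = "(a = 0 \<and> c = b) \<or> (b = 0 \<and> a = c)"
  have "D \<ge> 0 \<and> (D = 0 \<longrightarrow> ?E)"
  proof (cases "a < c")
    case True
    let ?t = "8 * (a^2 * b * (3 * c - a))"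
    have D: "D = (a + b - c)^4 + ?t"
      unfolding D_def by algebra
    have t: "?t \<ge> 0"
      using assms True by simp
    have "?E" if "D = 0"
    proof -
      have "(a + b - c)^4 = 0" "?t = 0"
        using that t add_nonneg_eq_0_iff[of "(a + b - c)^4" ?t] unfolding D by auto
      then show ?thesis
        using True assms by auto
    qed
    then show ?thesis
      unfolding D using t by simp
  next
    case False
    define d where "d = a - c"
    have d: "d \<ge> 0"
      using False by (simp add: d_def)
    \<comment> \<open>The first summand is \<open>(d + b)\<^sup>4 - 8 d\<^sup>3 b\<close>, and the second is \<open>8 d\<^sup>3 b - 8 a\<^sup>2 b (a - 3 c)\<close>.\<close>
    let ?u = "(d^2 - 2 * d * b)^2 + 2 * d^2 * b^2 + 4 * d * b^3 + b^4"
    let ?v = "8 * b * c^2 * (3 * a - c)"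
    have D: "D = ?u + ?v"
      unfolding D_def d_def by algebra
    have v: "?v \<ge> 0"
      using assms False by simp
    have u: "?u \<ge> b^4"
      using assms d by simp
    have "?E" if "D = 0"
    proof -
      have "b^4 \<le> 0"
        using that u v unfolding D by linarith
      then have "b = 0"
        by simp
      moreover from this have "d = 0"
        using that unfolding D by simp
      ultimately show ?thesis
        by (simp add: d_def)
    qed
    moreover have "b^4 \<ge> 0"
      by simp
    ultimately show ?thesis
      unfolding D using u v by linarith
  qed
  then show "D \<ge> 0" and "D = 0 \<longleftrightarrow> ?E"
    unfolding D_def by auto
qed

text \<open>
  Each part of the theorem has this shape; the equation \<open>L - R = P - Q\<close> is what makes its two
  formulations equivalent.
\<close>

lemma equivalent_inequalities:
  fixes L R P Q :: real
  assumes "L - R = P - Q" and "P - Q \<ge> 0" and "P - Q = 0 \<longleftrightarrow> E"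
  shows "L \<ge> R \<and> (L \<ge> R \<longleftrightarrow> P \<ge> Q) \<and> P \<ge> Q \<and> (L = R \<longleftrightarrow> E) \<and> (P = Q \<longleftrightarrow> E)"
  using assms by auto

theorem theorem3p13:
  fixes x1 x2 x3 :: real
  assumes "x1 \<ge> 0" and "x2 \<ge> 0" and "x3 \<ge> 0"
  shows
    "(let L = x1^4 + x2^4 + x3^4 + 6 * x1^2 * x2^2 + 6 * x1^2 * x3^2 + 6 * x2^2 * x3^2 + 12 * x1^2 * x2 * x3 + 12 * x1 * x2 * x3^2 + 12 * x1 * x2^2 * x3;
          R = 4 * x1^3 * x3 + 4 * x1 * x2^3 + 4 * x2^3 * x3 + 4 * x2 * x3^3 + 4 * x1^3 * x2 + 4 * x1 * x3^3;
          P = (x1 + x2 + x3)^4;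
          Q = 8 * (x1^3 * x3 + x1 * x2^3 + x2^3 * x3 + x2 * x3^3 + x1^3 * x2 + x1 * x3^3);
          E = ((x1 = x2 \<and> x3 = 0) \<or> (x1 = x3 \<and> x2 = 0) \<or> (x2 = x3 \<and> x1 = 0))
      in L \<ge> R \<and> (L \<ge> R \<longleftrightarrow> P \<ge> Q) \<and> P \<ge> Q \<and> (L = R \<longleftrightarrow> E) \<and> (P = Q \<longleftrightarrow> E)) \<and>
     (let L = x1^4 + x2^4 + x3^4 + 6 * x1^2 * x2^2 + 6 * x1^2 * x3^2 + 6 * x2^2 * x3^2 + 12 * x1^2 * x2 * x3 + 12 * x1 * x2 * x3^2 + 4 * x1 * x2^3;
          R = 4 * x1^3 * x3 + 4 * x1 * x3^3 + 4 * x2^3 * x3 + 4 * x2 * x3^3 + 4 * x1^3 * x2 + 12 * x1 * x2^2 * x3;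
          P = (x1 + x2 - x3)^4;
          Q = 8 * x1^2 * x2 * (x1 - 3 * x3);
          E = ((x1 = 0 \<and> x3 = x2) \<or> (x2 = 0 \<and> x1 = x3))
      in L \<ge> R \<and> (L \<ge> R \<longleftrightarrow> P \<ge> Q) \<and> P \<ge> Q \<and> (L = R \<longleftrightarrow> E) \<and> (P = Q \<longleftrightarrow> E)) \<and>
     (let L = x1^4 + x2^4 + x3^4 + 6 * x1^2 * x2^2 + 6 * x1^2 * x3^2 + 6 * x2^2 * x3^2 + 12 * x1 * x2^2 * x3 + 12 * x1 * x2 * x3^2 + 4 * x1^3 * x3;
          R = 4 * x1 * x2^3 + 4 * x1 * x3^3 + 4 * x2^3 * x3 + 4 * x2 * x3^3 + 4 * x1^3 * x2 + 12 * x1^2 * x2 * x3;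
          P = (x1 - x2 + x3)^4;
          Q = 8 * x1 * x3^2 * (x3 - 3 * x2);
          E = ((x1 = x2 \<and> x3 = 0) \<or> (x1 = 0 \<and> x2 = x3))
      in L \<ge> R \<and> (L \<ge> R \<longleftrightarrow> P \<ge> Q) \<and> P \<ge> Q \<and> (L = R \<longleftrightarrow> E) \<and> (P = Q \<longleftrightarrow> E)) \<and>
     (let L = x1^4 + x2^4 + x3^4 + 6 * x1^2 * x2^2 + 6 * x1^2 * x3^2 + 6 * x2^2 * x3^2 + 12 * x1 * x2^2 * x3 + 12 * x1^2 * x2 * x3 + 4 * x2 * x3^3;
          R = 4 * x1^3 * x3 + 4 * x1 * x3^3 + 4 * x2^3 * x3 + 4 * x1 * x2^3 + 4 * x1^3 * x2 + 12 * x1 * x2 * x3^2;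
          P = (x2 + x3 - x1)^4;
          Q = 8 * x2^2 * x3 * (x2 - 3 * x1);
          E = ((x1 = x2 \<and> x3 = 0) \<or> (x2 = 0 \<and> x1 = x3))
      in L \<ge> R \<and> (L \<ge> R \<longleftrightarrow> P \<ge> Q) \<and> P \<ge> Q \<and> (L = R \<longleftrightarrow> E) \<and> (P = Q \<longleftrightarrow> E))"
proof -
  note part_a = symmetric_quartic_nonneg[OF assms]
  note part_b = fourth_power_ge_cubic_product[OF assms(1,2,3)]
  note part_c = fourth_power_ge_cubic_product[OF assms(3,1,2)]
  note part_d = fourth_power_ge_cubic_product[OF assms(2,3,1)]
  have c: "x1 - x2 + x3 = x3 + x1 - x2" "8 * x1 * x3^2 * (x3 - 3 * x2) = 8 * x3^2 * x1 * (x3 - 3 * x2)"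
    by simp_all
  show ?thesis
    unfolding Let_def
  proof (intro conjI[OF equivalent_inequalities] equivalent_inequalities, goal_cases)
    case 1 show ?case by algebra
  next
    case 2 show ?case by (rule part_a(1))
  next
    case 3 show ?case by (rule part_a(2))
  next
    case 4 show ?case by algebra
  next
    case 5 show ?case by (rule part_b(1))
  next
    case 6 show ?case by (rule part_b(2))
  next
    case 7 show ?case by algebra
  next
    case 8 show ?case unfolding c by (rule part_c(1))
  next
    case 9 show ?case unfolding c part_c(2) by auto
  next
    case 10 show ?case by algebra
  next
    case 11 show ?case by (rule part_d(1))
  next
    case 12 show ?case unfolding part_d(2) by auto
  qed
qed

end
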